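(* Let $G_n=(V(G_n),E(G_n))$, $n\geq 1$, be random graphs with $|V(G_n)|=n$. Assume that $G_n$ converges locally in probability to $(G,o)\sim\mu$, and write $\zeta=\mu(|\mathscr{C}(o)|=\infty)$. If $|\mathscr{C}_{\rm max}|/n\to\zeta$ in probability as $n\to\infty$, then $$\lim_{k\to\infty}\limsup_{n\to\infty}\frac{1}{n^2}\mathbb{E}\Big[\#\big\{(x,y)\in V(G_n)\times V(G_n)\colon |\mathscr{C}(x)|\geq k,\ |\mathscr{C}(y)|\geq k,\ x\notin\mathscr{C}(y)\big\}\Big]=0.$$
   Context: Graphs $G=(V(G),E(G))$ are locally finite. For $v\in V(G)$, $\mathscr{C}(v)$ denotes the connected component of $v$, and $|\mathscr{C}(v)|$ its number of vertices. $\mathscr{C}_{\rm max}$ is the largest connected component of $G_n$ (ties broken arbitrarily). Local convergence in probability: Let $\mathscr{G}_\star$ be the set of (possibly infinite) locally finite connected rooted graphs modulo rooted isomorphism $\simeq$ (a bijection of vertex sets preserving the root and adjacency). With $d_G$ the graph distance, $B_r^{(G)}(o)$ is the subgraph rooted at $o$ with vertex set $\{u\colon d_G(o,u)\leq r\}$ and all edges of $G$ between such vertices. Let $\mu$ be a probability measure on $\mathscr{G}_\star$, and let $(G,o)\sim\mu$. Then $G_n$ converges locally in probability to $(G,o)\sim\mu$ when, for every integer $r\geq 0$ and $H_\star\in\mathscr{G}_\star$, $\frac{1}{|V(G_n)|}\sum_{v\in V(G_n)}\mathbf{1}_{\{B_r^{(G_n)}(v)\simeq H_\star\}}$ converges in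 probability to $\mu(B_r^{(G)}(o)\simeq H_\star)$. *)

theory Defs
  imports "HOL-Probability.Probability"
begin

subsection \<open>Locally finite simple graphs\<close>

datatype 'v graph = Graph (verts: "'v set") (edges: "'v set set")

definition neighbours :: "'v graph \<Rightarrow> 'v \<Rightarrow> 'v set" where
  "neighbours G v = {u. {u, v} \<in> edges G}"

definition locally_finite_graph :: "'v graph \<Rightarrow> bool" where
  "locally_finite_graph G \<longleftrightarrow>
     (\<forall>e\<in>edges G. e \<subseteq> verts G \<and> card e = 2) \<and>
     (\<forall>v\<in>verts G. finite (neighbours G v))"

definition adj_rel :: "'v graph \<Rightarrow> ('v \<times> 'v) set" where
  "adj_rel G = {(u, v). {u, v} \<in> edges G}"

definition component :: "'v graph \<Rightarrow> 'v \<Rightarrow> 'v set" where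
  "component G v = {u \<in> verts G. (v, u) \<in> (adj_rel G)\<^sup>*}"

definition components :: "'v graph \<Rightarrow> 'v set set" where
  "components G = component G ` verts G"

text \<open>The number of vertices of a largest component; it does not depend on how ties are
  broken. It is meant for finite nonempty graphs only.\<close>

definition max_component_size :: "'v graph \<Rightarrow> nat" where
  "max_component_size G = Max (card ` components G)"

definition connected_graph :: "'v graph \<Rightarrow> bool" where
  "connected_graph G \<longleftrightarrow> (\<forall>u\<in>verts G. \<forall>v\<in>verts G. v \<in> component G u)"

text \<open>The length of a shortest walk, and \<open>\<infinity>\<close> if there is no walk.\<close>

definition graph_dist :: "'v graph \<Rightarrow> 'v \<Rightarrow> 'v \<Rightarrow> enat" where
  "graph_dist G u v = Inf {enat l | l. (u, v) \<in> adj_rel G ^^ l}"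

subsection \<open>Rooted graphs and balls\<close>

type_synonym 'v rooted_graph = "'v graph \<times> 'v"

definition ball_verts :: "nat \<Rightarrow> 'v graph \<Rightarrow> 'v \<Rightarrow> 'v set" where
  "ball_verts r G v = {u \<in> verts G. graph_dist G v u \<le> enat r}"

definition graph_ball :: "nat \<Rightarrow> 'v graph \<Rightarrow> 'v \<Rightarrow> 'v rooted_graph" where
  "graph_ball r G v =
     (Graph (ball_verts r G v) {e \<in> edges G. e \<subseteq> ball_verts r G v}, v)"

definition rooted_iso :: "'v rooted_graph \<Rightarrow> 'u rooted_graph \<Rightarrow> bool"
    (infix "\<simeq>\<^sub>\<star>" 50) where
  "R \<simeq>\<^sub>\<star> S \<longleftrightarrow>
     (\<exists>\<phi>. bij_betw \<phi> (verts (fst R)) (verts (fst S)) \<and> \<phi> (snd R) = snd S \<and>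
        (\<forall>u\<in>verts (fst R). \<forall>v\<in>verts (fst R).
           {u, v} \<in> edges (fst R) \<longleftrightarrow> {\<phi> u, \<phi> v} \<in> edges (fst S)))"

subsection \<open>The space of rooted graphs modulo isomorphism\<close>

text \<open>A connected locally finite graph has countably many vertices, so every isomorphism class
  has a representative whose vertices are natural numbers.\<close>

definition rooted_graphs :: "nat rooted_graph set" where
  "rooted_graphs =
     {(G, v) | G v. locally_finite_graph G \<and> connected_graph G \<and> v \<in> verts G}"

definition Gstar :: "nat rooted_graph set set" where
  "Gstar = rooted_graphs // {(R, S). R \<in> rooted_graphs \<and> S \<in> rooted_graphs \<and> R \<simeq>\<^sub>\<star> S}"

text \<open>The two events below are isomorphism invariant, so it does not matter which representative
  of the class is taken.\<close>

definition ball_event :: "nat \<Rightarrow> nat rooted_graph \<Rightarrow> nat rooted_graph set set" where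
  "ball_event r H = {c \<in> Gstar. \<exists>(G, v)\<in>c. graph_ball r G v \<simeq>\<^sub>\<star> H}"

definition infinite_event :: "nat rooted_graph set set" where
  "infinite_event = {c \<in> Gstar. \<exists>(G, v)\<in>c. infinite (component G v)}"

text \<open>The events \<open>ball_event r H\<close> are the balls of the local metric, and there are countably
  many of them; hence they generate the Borel sets of the local topology.\<close>

definition Gstar_measurable_space :: "nat rooted_graph set measure" where
  "Gstar_measurable_space = sigma Gstar {ball_event r H | r H. H \<in> rooted_graphs}"

subsection \<open>Random graphs and convergence in probability\<close>

text \<open>Measurability for the discrete \<open>\<sigma>\<close>-algebra makes every function of the graph a random
  variable. For a fixed finite vertex set it says that every event
  \<open>{u, v} \<in> edges (G \<omega>)\<close> is measurable.\<close>

definition is_random_graph :: "'w measure \<Rightarrow> ('w \<Rightarrow> 'v graph) \<Rightarrow> nat \<Rightarrow> bool" where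
  "is_random_graph P G n \<longleftrightarrow>
     prob_space P \<and> G \<in> P \<rightarrow>\<^sub>M count_space UNIV \<and>
     (\<forall>\<omega>\<in>space P. locally_finite_graph (G \<omega>) \<and>
        finite (verts (G \<omega>)) \<and> card (verts (G \<omega>)) = n)"

text \<open>The limit is a constant, so the variables may live on different probability spaces.\<close>

definition conv_in_prob :: "(nat \<Rightarrow> 'w measure) \<Rightarrow> (nat \<Rightarrow> 'w \<Rightarrow> real) \<Rightarrow> real \<Rightarrow> bool" where
  "conv_in_prob P X c \<longleftrightarrow>
     (\<forall>\<epsilon>>0. (\<lambda>n. measure (P n) {\<omega> \<in> space (P n). \<bar>X n \<omega> - c\<bar> > \<epsilon>}) \<longlonglongrightarrow> 0)"

definition ball_frequency :: "nat \<Rightarrow> nat rooted_graph \<Rightarrow> 'v graph \<Rightarrow> real" where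
  "ball_frequency r H G =
     (1 / real (card (verts G))) * (\<Sum>v\<in>verts G. of_bool (graph_ball r G v \<simeq>\<^sub>\<star> H))"

definition conv_locally_in_prob ::
  "(nat \<Rightarrow> 'w measure) \<Rightarrow> (nat \<Rightarrow> 'w \<Rightarrow> 'v graph) \<Rightarrow> nat rooted_graph set measure \<Rightarrow> bool" where
  "conv_locally_in_prob P G \<mu> \<longleftrightarrow>
     (\<forall>r. \<forall>H\<in>rooted_graphs.
        conv_in_prob P (\<lambda>n \<omega>. ball_frequency r H (G n \<omega>)) (measure \<mu> (ball_event r H)))"

definition large_disconnected_pairs :: "nat \<Rightarrow> 'v graph \<Rightarrow> ('v \<times> 'v) set" where
  "large_disconnected_pairs k G =
     {(x, y) \<in> verts G \<times> verts G.
        card (component G x) \<ge> k \<and> card (component G y) \<ge> k \<and> x \<notin> component G y}"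

end

theory Submission
  imports Defs
begin

text \<open>
  Let \<open>Z\<close> be the number of vertices of \<open>G\<^sub>n\<close> whose component has at least \<open>k\<close> vertices, and
  let \<open>M\<close> be the size of a largest component \<open>C\<close>. If \<open>M < k\<close>, no pair is counted. Otherwise all
  vertices of \<open>C\<close> are among the \<open>Z\<close> vertices, and no pair inside \<open>C\<close> is counted, so the number of
  pairs is at most \<open>Z\<^sup>2 - M\<^sup>2\<close>. In both cases it is at most \<open>2n\<bar>Z - M\<bar>\<close>
  (\<open>card_large_disconnected_pairs_le\<close>).

  The event that a component has fewer than \<open>k\<close> vertices is local: it holds if and only if the
  ball of radius \<open>k\<close> has fewer than \<open>k\<close> vertices, and then the ball is the component
  (\<open>small_ball_verts_iff\<close>). So it is a union of events ``the ball of radius \<open>k\<close> is isomorphic to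
  \<open>H\<close>'' with \<open>H\<close> in a finite set of rooted graphs, and \<open>1 - Z/n\<close> is a finite linear
  combination of ball frequencies (\<open>large_component_frequency\<close>). The same combination of limit
  probabilities is the probability that the limit graph has fewer than \<open>k\<close> vertices
  (\<open>measure_small_event\<close>). Hence local convergence gives \<open>Z/n \<longrightarrow> \<zeta>\<^sub>k\<close>, the probability under
  \<open>\<mu>\<close> of at least \<open>k\<close> vertices, while \<open>M/n \<longrightarrow> \<zeta>\<close> by hypothesis.

  All these variables lie in \<open>[0, 1]\<close>, so convergence in probability is convergence in \<open>L\<^sup>1\<close>
  (\<open>conv_in_prob_L1\<close>). Therefore the limsup over \<open>n\<close> is at most \<open>2\<bar>\<zeta>\<^sub>k - \<zeta>\<bar>\<close>
  (\<open>limsup_disconnected_pairs_le\<close>), which tends to \<open>0\<close> because \<open>\<mu>\<close> is continuous along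
  increasing events (\<open>measure_small_event_limit\<close>).
\<close>

section \<open>Components and balls\<close>

lemma sym_adj_rel: "sym (adj_rel G)"
  unfolding adj_rel_def sym_def by (auto simp: insert_commute)

lemma adj_rel_verts:
  assumes "locally_finite_graph G" "(u, v) \<in> adj_rel G"
  shows "u \<in> verts G" "v \<in> verts G"
  using assms unfolding locally_finite_graph_def adj_rel_def by auto

lemma component_eq:
  assumes "u \<in> component G v"
  shows "component G u = component G v"
proof -
  have "(v, u) \<in> (adj_rel G)\<^sup>*" using assms by (simp add: component_def)
  moreover have "(u, v) \<in> (adj_rel G)\<^sup>*"
    using calculation sym_rtrancl[OF sym_adj_rel] by (meson symD)
  ultimately show ?thesis
    unfolding component_def by (auto intro: rtrancl_trans)
qed

lemma component_refl: "v \<in> verts G \<Longrightarrow> v \<in> component G v"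
  by (simp add: component_def)

lemma component_connected_graph:
  "connected_graph G \<Longrightarrow> v \<in> verts G \<Longrightarrow> component G v = verts G"
  unfolding connected_graph_def component_def by auto

lemma graph_dist_le_iff:
  "graph_dist G v u \<le> enat r \<longleftrightarrow> (\<exists>l\<le>r. (v, u) \<in> adj_rel G ^^ l)"
proof
  let ?A = "{enat l | l. (v, u) \<in> adj_rel G ^^ l}"
  assume le: "graph_dist G v u \<le> enat r"
  have "?A \<noteq> {}"
  proof
    assume empty: "?A = {}"
    have "graph_dist G v u = \<infinity>"
      unfolding graph_dist_def empty by (simp add: Inf_enat_def)
    with le show False by simp
  qed
  then obtain x where "x \<in> ?A" by blast
  then have "Inf ?A \<in> ?A" by (rule wellorder_InfI)
  then show "\<exists>l\<le>r. (v, u) \<in> adj_rel G ^^ l"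
    using le unfolding graph_dist_def by auto
next
  assume "\<exists>l\<le>r. (v, u) \<in> adj_rel G ^^ l"
  then obtain l where "l \<le> r" "(v, u) \<in> adj_rel G ^^ l" by auto
  then have "Inf {enat l | l. (v, u) \<in> adj_rel G ^^ l} \<le> enat l"
    by (auto intro: Inf_lower)
  then show "graph_dist G v u \<le> enat r"
    unfolding graph_dist_def using \<open>l \<le> r\<close> by (meson enat_ord_simps(1) order_trans)
qed

lemma ball_verts_eq:
  "ball_verts r G v = {u \<in> verts G. \<exists>l\<le>r. (v, u) \<in> adj_rel G ^^ l}"
  by (simp add: ball_verts_def graph_dist_le_iff)

lemma ball_verts_subset_component: "ball_verts r G v \<subseteq> component G v"
  unfolding ball_verts_eq component_def by (auto intro: relpow_imp_rtrancl)

lemma root_in_ball_verts: "v \<in> verts G \<Longrightarrow> v \<in> ball_verts r G v"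
proof -
  have "(v, v) \<in> adj_rel G ^^ 0" by simp
  then show "v \<in> verts G \<Longrightarrow> v \<in> ball_verts r G v" unfolding ball_verts_eq by blast
qed

lemma ball_verts_mono: "r \<le> s \<Longrightarrow> ball_verts r G v \<subseteq> ball_verts s G v"
  unfolding ball_verts_eq by (auto dest: order_trans)

lemma ball_verts_step:
  assumes "locally_finite_graph G" "u \<in> ball_verts r G v" "(u, w) \<in> adj_rel G"
  shows "w \<in> ball_verts (Suc r) G v"
proof -
  obtain l where l: "l \<le> r" "(v, u) \<in> adj_rel G ^^ l"
    using assms(2) by (auto simp: ball_verts_eq)
  then have "(v, w) \<in> adj_rel G ^^ Suc l" using assms(3) by auto
  moreover have "Suc l \<le> Suc r" using l(1) by simp
  ultimately show ?thesis
    using adj_rel_verts(2)[OF assms(1,3)] unfolding ball_verts_eq by blast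
qed

text \<open>A ball that does not grow from one radius to the next is closed under adjacency, so it
  is the whole component; until that happens, each step of the radius adds a vertex.\<close>

lemma ball_verts_large_or_component:
  assumes lf: "locally_finite_graph G" and v: "v \<in> verts G"
    and fin: "finite (ball_verts k G v)" and "r \<le> k"
  shows "r < card (ball_verts r G v) \<or> component G v \<subseteq> ball_verts r G v"
  using \<open>r \<le> k\<close>
proof (induction r)
  case 0
  have "ball_verts 0 G v = {v}" using v by (auto simp: ball_verts_eq)
  then show ?case by simp
next
  case (Suc r)
  have sub: "ball_verts r G v \<subseteq> ball_verts (Suc r) G v" by (rule ball_verts_mono) simp
  show ?case
  proof (cases "ball_verts (Suc r) G v = ball_verts r G v")
    case True
    have "u \<in> ball_verts r G v" if "(v, u) \<in> (adj_rel G)\<^sup>*" for u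
      using that
    proof (induction rule: rtrancl_induct)
      case base
      show ?case using v by (rule root_in_ball_verts)
    next
      case (step y z)
      then show ?case using ball_verts_step[OF lf] True by blast
    qed
    then show ?thesis using sub by (auto simp: component_def)
  next
    case False
    have "finite (ball_verts (Suc r) G v)"
      by (rule finite_subset[OF ball_verts_mono[OF Suc.prems] fin])
    then have "card (ball_verts r G v) < card (ball_verts (Suc r) G v)"
      by (rule psubset_card_mono) (use False sub in blast)
    then have "component G v \<subseteq> ball_verts r G v \<or> Suc r < card (ball_verts (Suc r) G v)"
      using Suc.IH Suc.prems by linarith
    then show ?thesis using sub by blast
  qed
qed

text \<open>This makes the size of a component, up to a threshold \<open>k\<close>, a function of the ball of
  radius \<open>k\<close>.\<close>

lemma small_ball_verts_iff:
  assumes lf: "locally_finite_graph G" and v: "v \<in> verts G"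
  shows "finite (ball_verts k G v) \<and> card (ball_verts k G v) < k \<longleftrightarrow>
    finite (component G v) \<and> card (component G v) < k"
proof
  assume "finite (ball_verts k G v) \<and> card (ball_verts k G v) < k"
  then show "finite (component G v) \<and> card (component G v) < k"
    using ball_verts_large_or_component[OF lf v, of k k] subset_antisym[OF ball_verts_subset_component]
    by (metis less_asym order_refl)
next
  assume "finite (component G v) \<and> card (component G v) < k"
  then show "finite (ball_verts k G v) \<and> card (ball_verts k G v) < k"
    using ball_verts_subset_component[of k G v] card_mono finite_subset le_less_trans
    by metis
qed

lemma small_ball_verts_eq:
  assumes lf: "locally_finite_graph G" and v: "v \<in> verts G"
    and "finite (component G v)" "card (component G v) < k"
  shows "ball_verts k G v = component G v"
proof (rule subset_antisym[OF ball_verts_subset_component])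
  have "finite (ball_verts k G v)" "\<not> k < card (ball_verts k G v)"
    using small_ball_verts_iff[OF lf v, of k] assms(3,4) by auto
  then show "component G v \<subseteq> ball_verts k G v"
    using ball_verts_large_or_component[OF lf v, of k k] by blast
qed

lemma graph_ball_connected:
  assumes lf: "locally_finite_graph G" and con: "connected_graph G" and v: "v \<in> verts G"
    and small: "finite (verts G)" "card (verts G) < k"
  shows "graph_ball k G v = (G, v)"
proof -
  have "ball_verts k G v = verts G"
    using small_ball_verts_eq[OF lf v] small component_connected_graph[OF con v] by simp
  moreover have "{e \<in> edges G. e \<subseteq> verts G} = edges G"
    using lf unfolding locally_finite_graph_def by auto
  ultimately show ?thesis unfolding graph_ball_def by simp
qed

section \<open>Rooted isomorphism and the finitely many small rooted graphs\<close>

lemma rooted_isoI: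
  assumes "bij_betw \<phi> (verts (fst R)) (verts (fst S))" "\<phi> (snd R) = snd S"
    and "\<And>u v. u \<in> verts (fst R) \<Longrightarrow> v \<in> verts (fst R) \<Longrightarrow>
      {u, v} \<in> edges (fst R) \<longleftrightarrow> {\<phi> u, \<phi> v} \<in> edges (fst S)"
  shows "R \<simeq>\<^sub>\<star> S"
  unfolding rooted_iso_def using assms by (intro exI[of _ \<phi>] conjI ballI)

lemma rooted_isoE:
  assumes "R \<simeq>\<^sub>\<star> S"
  obtains \<phi> where "bij_betw \<phi> (verts (fst R)) (verts (fst S))" "\<phi> (snd R) = snd S"
    "\<And>u v. u \<in> verts (fst R) \<Longrightarrow> v \<in> verts (fst R) \<Longrightarrow>
      {u, v} \<in> edges (fst R) \<longleftrightarrow> {\<phi> u, \<phi> v} \<in> edges (fst S)"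
proof -
  from assms obtain \<phi> where "bij_betw \<phi> (verts (fst R)) (verts (fst S)) \<and> \<phi> (snd R) = snd S \<and>
      (\<forall>u\<in>verts (fst R). \<forall>v\<in>verts (fst R).
        {u, v} \<in> edges (fst R) \<longleftrightarrow> {\<phi> u, \<phi> v} \<in> edges (fst S))"
    unfolding rooted_iso_def by (rule exE)
  then show thesis by (intro that[of \<phi>]) simp_all
qed

lemma rooted_iso_refl: "R \<simeq>\<^sub>\<star> R"
  by (rule rooted_isoI[where \<phi> = id]) simp_all

lemma rooted_iso_sym:
  assumes "R \<simeq>\<^sub>\<star> S" "snd R \<in> verts (fst R)"
  shows "S \<simeq>\<^sub>\<star> R"
proof -
  obtain \<phi> where b: "bij_betw \<phi> (verts (fst R)) (verts (fst S))" and r: "\<phi> (snd R) = snd S"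
    and e: "\<And>u v. u \<in> verts (fst R) \<Longrightarrow> v \<in> verts (fst R) \<Longrightarrow>
      {u, v} \<in> edges (fst R) \<longleftrightarrow> {\<phi> u, \<phi> v} \<in> edges (fst S)"
    using assms(1) by (rule rooted_isoE) blast
  let ?\<psi> = "inv_into (verts (fst R)) \<phi>"
  have b': "bij_betw ?\<psi> (verts (fst S)) (verts (fst R))" using b by (rule bij_betw_inv_into)
  have "?\<psi> (snd S) = snd R"
    using b r assms(2) by (metis bij_betw_inv_into_left)
  moreover have "{u, v} \<in> edges (fst S) \<longleftrightarrow> {?\<psi> u, ?\<psi> v} \<in> edges (fst R)"
    if "u \<in> verts (fst S)" "v \<in> verts (fst S)" for u v
    using e[of "?\<psi> u" "?\<psi> v"] that b b'
    by (simp add: bij_betw_inv_into_right bij_betwE)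
  ultimately show ?thesis using b' by (intro rooted_isoI[where \<phi> = ?\<psi>])
qed

lemma rooted_iso_trans:
  assumes "R \<simeq>\<^sub>\<star> S" "S \<simeq>\<^sub>\<star> T"
  shows "R \<simeq>\<^sub>\<star> T"
proof -
  obtain \<phi> where 1: "bij_betw \<phi> (verts (fst R)) (verts (fst S))" "\<phi> (snd R) = snd S"
    "\<And>u v. u \<in> verts (fst R) \<Longrightarrow> v \<in> verts (fst R) \<Longrightarrow>
      {u, v} \<in> edges (fst R) \<longleftrightarrow> {\<phi> u, \<phi> v} \<in> edges (fst S)"
    using assms(1) by (rule rooted_isoE) blast
  obtain \<psi> where 2: "bij_betw \<psi> (verts (fst S)) (verts (fst T))" "\<psi> (snd S) = snd T"
    "\<And>u v. u \<in> verts (fst S) \<Longrightarrow> v \<in> verts (fst S) \<Longrightarrow>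
      {u, v} \<in> edges (fst S) \<longleftrightarrow> {\<psi> u, \<psi> v} \<in> edges (fst T)"
    using assms(2) by (rule rooted_isoE) blast
  show ?thesis
    using bij_betw_trans[OF 1(1) 2(1)] 1(2,3) 2(2,3) bij_betwE[OF 1(1)]
    by (intro rooted_isoI[where \<phi> = "\<psi> \<circ> \<phi>"]) simp_all
qed

lemma rooted_iso_card:
  assumes "R \<simeq>\<^sub>\<star> S"
  shows "finite (verts (fst R)) = finite (verts (fst S))"
    "card (verts (fst R)) = card (verts (fst S))"
  using assms by (auto elim!: rooted_isoE dest: bij_betw_finite bij_betw_same_card)

text \<open>A finite set that meets every isomorphism class of connected rooted graphs with fewer than
  \<open>k\<close> vertices. A class may have several members in it.\<close>

definition small_graphs :: "nat \<Rightarrow> nat rooted_graph set" where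
  "small_graphs k = {(Graph {..<m} E, v) | m E v.
     m < k \<and> (Graph {..<m} E, v) \<in> rooted_graphs}"

lemma finite_small_graphs: "finite (small_graphs k)"
proof -
  have "small_graphs k \<subseteq>
    (\<lambda>(m, E, v). (Graph {..<m} E, v)) ` ({..<k} \<times> Pow (Pow {..<k}) \<times> {..<k})"
  proof
    fix H assume "H \<in> small_graphs k"
    then obtain m E v where H: "H = (Graph {..<m} E, v)" "m < k"
      "(Graph {..<m} E, v) \<in> rooted_graphs"
      unfolding small_graphs_def by blast
    from H(3) have "E \<subseteq> Pow {..<m}" "v < m"
      unfolding rooted_graphs_def locally_finite_graph_def by auto
    then have "E \<in> Pow (Pow {..<k})" "v < k" using H(2) by force+
    then show "H \<in> (\<lambda>(m, E, v). (Graph {..<m} E, v)) ` ({..<k} \<times> Pow (Pow {..<k}) \<times> {..<k})"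
      using H by (intro image_eqI[where x = "(m, E, v)"]) auto
  qed
  then show ?thesis by (rule finite_subset) (intro finite_imageI finite_cartesian_product; simp)
qed

lemma small_graphsD:
  assumes "H \<in> small_graphs k"
  shows "H \<in> rooted_graphs" "finite (verts (fst H))" "card (verts (fst H)) < k"
    "snd H \<in> verts (fst H)"
  using assms unfolding small_graphs_def rooted_graphs_def by auto

text \<open>Numbering the vertices of the component gives the copy. It is connected because a walk
  that starts in a component never leaves it, so the numbering carries the whole walk over.\<close>

lemma component_rooted_iso_small:
  fixes G :: "'v graph"
  assumes lf: "locally_finite_graph G" and v: "v \<in> verts G"
    and fin: "finite (component G v)" and small: "card (component G v) < k"
  shows "\<exists>H\<in>small_graphs k. (Graph (component G v) {e \<in> edges G. e \<subseteq> component G v}, v) \<simeq>\<^sub>\<star> H"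
proof -
  define C where "C = component G v"
  define m where "m = card C"
  obtain \<phi> where \<phi>: "bij_betw \<phi> C {..<m}"
    using ex_bij_betw_finite_nat[OF fin] unfolding C_def m_def
    by (auto simp: atLeast0LessThan)
  define E where "E = (`) \<phi> ` {e \<in> edges G. e \<subseteq> C}"
  define H where "H = Graph {..<m} E"
  have inj: "inj_on \<phi> C" and img: "\<phi> ` C = {..<m}"
    using \<phi> by (auto simp: bij_betw_def)
  have vC: "v \<in> C" using v by (simp add: C_def component_refl)
  have E2: "e \<subseteq> {..<m} \<and> card e = 2" if "e \<in> E" for e
  proof -
    from that obtain e' where e': "e' \<in> edges G" "e' \<subseteq> C" "e = \<phi> ` e'"
      unfolding E_def by auto
    then have "card e' = 2" using lf unfolding locally_finite_graph_def by auto
    then show ?thesis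
      using e' img card_image[OF inj_on_subset[OF inj e'(2)]] by auto
  qed
  have "finite (neighbours H u)" for u
  proof (rule finite_subset)
    show "neighbours H u \<subseteq> {..<m}"
      unfolding neighbours_def H_def using E2 by fastforce
  qed simp
  then have lfH: "locally_finite_graph H"
    unfolding locally_finite_graph_def using E2 by (auto simp: H_def)
  have path: "u \<in> C \<and> (\<phi> v, \<phi> u) \<in> (adj_rel H)\<^sup>*" if "(v, u) \<in> (adj_rel G)\<^sup>*" for u
    using that
  proof (induction rule: rtrancl_induct)
    case base
    show ?case using vC by simp
  next
    case (step y z)
    then have z: "z \<in> C"
      using adj_rel_verts(2)[OF lf step(2)] unfolding C_def component_def
      by (auto intro: rtrancl_into_rtrancl)
    then have "{y, z} \<in> {e \<in> edges G. e \<subseteq> C}"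
      using step by (auto simp: adj_rel_def)
    then have "\<phi> ` {y, z} \<in> E" unfolding E_def by blast
    then have "(\<phi> y, \<phi> z) \<in> adj_rel H" by (simp add: adj_rel_def H_def)
    then show ?case using step z by (auto intro: rtrancl_into_rtrancl)
  qed
  have root: "(\<phi> v, a) \<in> (adj_rel H)\<^sup>*" if "a < m" for a
  proof -
    have "a \<in> \<phi> ` C" using that img by simp
    then obtain u where "u \<in> C" "a = \<phi> u" by auto
    then show ?thesis using path unfolding C_def component_def by auto
  qed
  have "connected_graph H"
    unfolding connected_graph_def
  proof (intro ballI)
    fix a b assume "a \<in> verts H" "b \<in> verts H"
    then have "a < m" "b < m" by (auto simp: H_def)
    then have "(a, \<phi> v) \<in> (adj_rel H)\<^sup>*" "(\<phi> v, b) \<in> (adj_rel H)\<^sup>*"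
      using root sym_rtrancl[OF sym_adj_rel] by (meson symD)+
    then show "b \<in> component H a"
      using \<open>b < m\<close> by (auto simp: component_def H_def intro: rtrancl_trans)
  qed
  moreover have "\<phi> v \<in> verts H" using vC img by (auto simp: H_def)
  ultimately have "(H, \<phi> v) \<in> small_graphs k"
    using lfH small unfolding small_graphs_def rooted_graphs_def H_def m_def C_def by blast
  moreover have "(Graph C {e \<in> edges G. e \<subseteq> C}, v) \<simeq>\<^sub>\<star> (H, \<phi> v)"
  proof (rule rooted_isoI[where \<phi> = \<phi>])
    fix a b assume "a \<in> verts (fst (Graph C {e \<in> edges G. e \<subseteq> C}, v))"
      "b \<in> verts (fst (Graph C {e \<in> edges G. e \<subseteq> C}, v))"
    then have ab: "{a, b} \<subseteq> C" by auto
    have "{a, b} \<in> {e \<in> edges G. e \<subseteq> C} \<longleftrightarrow> \<phi> ` {a, b} \<in> E"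
      unfolding E_def using inj_on_image_eq_iff[OF inj ab] ab by blast
    then show "{a, b} \<in> edges (fst (Graph C {e \<in> edges G. e \<subseteq> C}, v)) \<longleftrightarrow>
        {\<phi> a, \<phi> b} \<in> edges (fst (H, \<phi> v))"
      by (simp add: H_def)
  qed (use \<phi> in \<open>auto simp: H_def\<close>)
  ultimately show ?thesis unfolding C_def by blast
qed

lemma graph_ball_small_iff:
  assumes lf: "locally_finite_graph G" and v: "v \<in> verts G"
  shows "(\<exists>H\<in>small_graphs k. graph_ball k G v \<simeq>\<^sub>\<star> H) \<longleftrightarrow>
    finite (component G v) \<and> card (component G v) < k"
proof
  assume "\<exists>H\<in>small_graphs k. graph_ball k G v \<simeq>\<^sub>\<star> H"
  then obtain H where H: "H \<in> small_graphs k" "graph_ball k G v \<simeq>\<^sub>\<star> H" by blast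
  have "finite (ball_verts k G v) \<and> card (ball_verts k G v) < k"
    using rooted_iso_card[OF H(2)] small_graphsD[OF H(1)] by (simp add: graph_ball_def)
  then show "finite (component G v) \<and> card (component G v) < k"
    using small_ball_verts_iff[OF lf v] by blast
next
  assume "finite (component G v) \<and> card (component G v) < k"
  then show "\<exists>H\<in>small_graphs k. graph_ball k G v \<simeq>\<^sub>\<star> H"
    using component_rooted_iso_small[OF lf v, of k] small_ball_verts_eq[OF lf v, of k]
    by (simp add: graph_ball_def)
qed

text \<open>A graph that is isomorphic to some member of \<open>small_graphs k\<close> is isomorphic to exactly
  the members in one isomorphism class. Dividing by the size of the class counts it once, which
  replaces a choice of representatives.\<close>

definition iso_weight :: "nat \<Rightarrow> nat rooted_graph \<Rightarrow> real" where
  "iso_weight k H = 1 / real (card {H' \<in> small_graphs k. H' \<simeq>\<^sub>\<star> H})"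

lemma iso_weight_nonneg: "iso_weight k H \<ge> 0"
  by (simp add: iso_weight_def)

lemma sum_iso_weight:
  assumes root: "snd R \<in> verts (fst R)"
  shows "(\<Sum>H\<in>small_graphs k. iso_weight k H * of_bool (R \<simeq>\<^sub>\<star> H)) =
    of_bool (\<exists>H\<in>small_graphs k. R \<simeq>\<^sub>\<star> H)"
proof -
  define A where "A = {H \<in> small_graphs k. R \<simeq>\<^sub>\<star> H}"
  have "finite A" unfolding A_def using finite_small_graphs by simp
  have "{H' \<in> small_graphs k. H' \<simeq>\<^sub>\<star> H} = A" if "H \<in> A" for H
  proof -
    have "R \<simeq>\<^sub>\<star> H" "snd H \<in> verts (fst H)"
      using that small_graphsD(4) unfolding A_def by auto
    then have "H' \<simeq>\<^sub>\<star> H \<longleftrightarrow> R \<simeq>\<^sub>\<star> H'" if "H' \<in> small_graphs k" for H'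
      using rooted_iso_trans rooted_iso_sym root small_graphsD(4)[OF that] by metis
    then show ?thesis unfolding A_def by blast
  qed
  then have w: "iso_weight k H = 1 / real (card A)" if "H \<in> A" for H
    using that by (simp add: iso_weight_def)
  have "(\<Sum>H\<in>small_graphs k. iso_weight k H * of_bool (R \<simeq>\<^sub>\<star> H)) = (\<Sum>H\<in>A. iso_weight k H)"
    unfolding A_def using finite_small_graphs
    by (intro sum.mono_neutral_cong_right) auto
  also have "\<dots> = real (card A) * (1 / real (card A))"
    by (simp add: w)
  also have "\<dots> = of_bool (A \<noteq> {})"
    using \<open>finite A\<close> by auto
  finally show ?thesis by (simp add: A_def Bex_def)
qed

section \<open>Pairs of large components in a finite graph\<close>

definition large_component_verts :: "nat \<Rightarrow> 'v graph \<Rightarrow> 'v set" where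
  "large_component_verts k G = {v \<in> verts G. k \<le> card (component G v)}"

text \<open>This is the passage from component sizes to the ball frequencies that local convergence
  controls: sum the indicator of a small component over all vertices and exchange the two sums.\<close>

lemma large_component_frequency:
  assumes lf: "locally_finite_graph G" and fin: "finite (verts G)" and ne: "verts G \<noteq> {}"
  shows "real (card (large_component_verts k G)) / real (card (verts G)) =
    1 - (\<Sum>H\<in>small_graphs k. iso_weight k H * ball_frequency k H G)"
proof -
  let ?n = "real (card (verts G))"
  have n: "?n > 0" using fin ne by (simp add: card_gt_0_iff)
  have sub: "component G v \<subseteq> verts G" for v by (auto simp: component_def)
  have pt: "(\<Sum>H\<in>small_graphs k. iso_weight k H * of_bool (graph_ball k G v \<simeq>\<^sub>\<star> H)) =
    1 - of_bool (v \<in> large_component_verts k G)" if v: "v \<in> verts G" for v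
  proof -
    have "snd (graph_ball k G v) \<in> verts (fst (graph_ball k G v))"
      using v by (simp add: graph_ball_def root_in_ball_verts)
    from sum_iso_weight[OF this, of k] show ?thesis
      using graph_ball_small_iff[OF lf v, of k] finite_subset[OF sub fin] v
      by (auto simp: large_component_verts_def)
  qed
  have "(\<Sum>H\<in>small_graphs k. iso_weight k H * ball_frequency k H G) =
    (1 / ?n) * (\<Sum>H\<in>small_graphs k. \<Sum>v\<in>verts G.
       iso_weight k H * of_bool (graph_ball k G v \<simeq>\<^sub>\<star> H))"
    by (simp add: ball_frequency_def sum_distrib_left mult_ac)
  also have "\<dots> = (1 / ?n) * (\<Sum>v\<in>verts G. \<Sum>H\<in>small_graphs k.
       iso_weight k H * of_bool (graph_ball k G v \<simeq>\<^sub>\<star> H))"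
    by (subst sum.swap) simp
  also have "\<dots> = (1 / ?n) * (\<Sum>v\<in>verts G. 1 - of_bool (v \<in> large_component_verts k G))"
    using pt by simp
  also have "\<dots> = (1 / ?n) * (?n - real (card (large_component_verts k G)))"
  proof -
    have "verts G \<inter> large_component_verts k G = large_component_verts k G"
      by (auto simp: large_component_verts_def)
    then show ?thesis using fin by (simp add: sum_subtractf sum_of_bool_eq Int_def)
  qed
  finally show ?thesis using n by (simp add: field_simps)
qed

text \<open>Pairs of vertices in large components number \<open>Z\<^sup>2\<close>, of which the \<open>M\<^sup>2\<close> inside a largest
  component are connected; what is left is \<open>(Z + M)(Z - M)\<close>, and \<open>Z\<close> and \<open>M\<close> are at most the
  number of vertices. The absolute value also covers the case that the largest component is below the threshold \<open>k\<close>.\<close>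

lemma card_large_disconnected_pairs_le:
  assumes fin: "finite (verts G)" and ne: "verts G \<noteq> {}"
  shows "real (card (large_disconnected_pairs k G)) \<le>
    2 * real (card (verts G)) *
      \<bar>real (card (large_component_verts k G)) - real (max_component_size G)\<bar>"
    and "max_component_size G \<le> card (verts G)"
proof -
  let ?Z = "large_component_verts k G" and ?M = "max_component_size G"
  have sub: "component G v \<subseteq> verts G" for v by (auto simp: component_def)
  have finC: "finite (card ` components G)" "card ` components G \<noteq> {}"
    using fin ne by (auto simp: components_def)
  from Max_in[OF finC] obtain x where x: "x \<in> verts G" "?M = card (component G x)"
    unfolding max_component_size_def components_def by auto
  show Mn: "?M \<le> card (verts G)" using x sub card_mono[OF fin] by simp
  have Zn: "card ?Z \<le> card (verts G)"
    by (intro card_mono fin) (auto simp: large_component_verts_def)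
  have le: "card (component G y) \<le> ?M" if "y \<in> verts G" for y
    unfolding max_component_size_def using that finC(1)
    by (intro Max_ge) (auto simp: components_def)
  show "real (card (large_disconnected_pairs k G)) \<le>
    2 * real (card (verts G)) * \<bar>real (card ?Z) - real ?M\<bar>"
  proof (cases "k \<le> ?M")
    case False
    then have "large_disconnected_pairs k G = {}"
      using le unfolding large_disconnected_pairs_def by fastforce
    then show ?thesis by simp
  next
    case True
    let ?C = "component G x"
    have CZ: "?C \<subseteq> ?Z"
      using True x sub component_eq[of _ G x] unfolding large_component_verts_def by auto
    have finZ: "finite ?Z" using fin by (simp add: large_component_verts_def)
    have "large_disconnected_pairs k G \<subseteq> ?Z \<times> ?Z - ?C \<times> ?C"
      using component_eq[of _ G x]
      unfolding large_disconnected_pairs_def large_component_verts_def by auto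
    then have "card (large_disconnected_pairs k G) \<le> card (?Z \<times> ?Z - ?C \<times> ?C)"
      using finZ by (intro card_mono) auto
    also have "\<dots> = card ?Z * card ?Z - ?M * ?M"
      using CZ finZ x(2) by (subst card_Diff_subset) (auto simp: card_cartesian_product intro: finite_subset)
    finally have "card (large_disconnected_pairs k G) \<le> card ?Z * card ?Z - ?M * ?M" .
    moreover have MZ: "?M \<le> card ?Z" using CZ finZ x(2) card_mono by metis
    ultimately have "real (card (large_disconnected_pairs k G)) \<le>
        real (card ?Z) * real (card ?Z) - real ?M * real ?M"
      using mult_le_mono[OF MZ MZ] by (metis of_nat_diff of_nat_le_iff of_nat_mult)
    also have "\<dots> = (real (card ?Z) + real ?M) * (real (card ?Z) - real ?M)"
      by (simp add: algebra_simps)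
    also have "\<dots> \<le> (2 * real (card (verts G))) * \<bar>real (card ?Z) - real ?M\<bar>"
      using Zn Mn MZ by (intro mult_mono) auto
    finally show ?thesis .
  qed
qed

section \<open>Finite and infinite components under the limit law\<close>

definition small_event :: "nat \<Rightarrow> nat rooted_graph set set" where
  "small_event k = (\<Union>H\<in>small_graphs k. ball_event k H)"

text \<open>All members of an isomorphism class are isomorphic to any chosen one, which lets the
  events below be read off a single representative.\<close>

lemma Gstar_elem:
  assumes "c \<in> Gstar"
  obtains G v where "(G, v) \<in> c" "locally_finite_graph G" "connected_graph G" "v \<in> verts G"
    "\<And>S. S \<in> c \<longleftrightarrow> S \<in> rooted_graphs \<and> (G, v) \<simeq>\<^sub>\<star> S"
proof -
  from assms obtain R where R: "R \<in> rooted_graphs"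
    "c = {(R, S). R \<in> rooted_graphs \<and> S \<in> rooted_graphs \<and> R \<simeq>\<^sub>\<star> S} `` {R}"
    unfolding Gstar_def by (rule quotientE)
  then have "S \<in> c \<longleftrightarrow> S \<in> rooted_graphs \<and> R \<simeq>\<^sub>\<star> S" for S by auto
  moreover obtain G v where "R = (G, v)" by force
  ultimately show ?thesis
    using that[of G v] R(1) rooted_iso_refl[of R] unfolding rooted_graphs_def by auto
qed

text \<open>The definition of \<open>ball_event\<close> allows any representative. For small \<open>H\<close> the choice is
  harmless without knowing that balls respect isomorphism in general: a ball of radius \<open>k\<close> with
  fewer than \<open>k\<close> vertices in a connected graph is the entire graph.\<close>

lemma ball_event_small_iff:
  assumes c: "c \<in> Gstar" and H: "H \<in> small_graphs k"
    and Gc: "(G, v) \<in> c" and iff: "\<And>S. S \<in> c \<longleftrightarrow> S \<in> rooted_graphs \<and> (G, v) \<simeq>\<^sub>\<star> S"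
  shows "c \<in> ball_event k H \<longleftrightarrow> (G, v) \<simeq>\<^sub>\<star> H"
proof -
  have small: "graph_ball k G' v' \<simeq>\<^sub>\<star> H \<longleftrightarrow> (G', v') \<simeq>\<^sub>\<star> H" if "(G', v') \<in> c" for G' v'
  proof -
    have G': "locally_finite_graph G'" "connected_graph G'" "v' \<in> verts G'"
      using that iff unfolding rooted_graphs_def by auto
    note comp = component_connected_graph[OF G'(2,3)]
    show ?thesis
    proof (cases "finite (verts G') \<and> card (verts G') < k")
      case True
      then show ?thesis using graph_ball_connected[OF G'] by simp
    next
      case False
      then show ?thesis
        using graph_ball_small_iff[OF G'(1,3), of k] H comp rooted_iso_card[of "(G', v')" H]
          small_graphsD[OF H] by auto
    qed
  qed
  show ?thesis
  proof
    assume "c \<in> ball_event k H"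
    then obtain G' v' where G': "(G', v') \<in> c" "graph_ball k G' v' \<simeq>\<^sub>\<star> H"
      unfolding ball_event_def by auto
    then show "(G, v) \<simeq>\<^sub>\<star> H" using small iff rooted_iso_trans by metis
  next
    assume "(G, v) \<simeq>\<^sub>\<star> H"
    then show "c \<in> ball_event k H" using small[OF Gc] Gc c unfolding ball_event_def by auto
  qed
qed

lemma small_event_iff:
  assumes c: "c \<in> Gstar"
    and Gc: "(G, v) \<in> c" and iff: "\<And>S. S \<in> c \<longleftrightarrow> S \<in> rooted_graphs \<and> (G, v) \<simeq>\<^sub>\<star> S"
  shows "c \<in> small_event k \<longleftrightarrow> finite (verts G) \<and> card (verts G) < k"
proof -
  have G: "locally_finite_graph G" "connected_graph G" "v \<in> verts G"
    using Gc iff unfolding rooted_graphs_def by auto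
  have "c \<in> small_event k \<longleftrightarrow> (\<exists>H\<in>small_graphs k. (G, v) \<simeq>\<^sub>\<star> H)"
    unfolding small_event_def using ball_event_small_iff[OF c _ Gc iff] by auto
  also have "\<dots> \<longleftrightarrow> finite (verts G) \<and> card (verts G) < k"
  proof
    assume "\<exists>H\<in>small_graphs k. (G, v) \<simeq>\<^sub>\<star> H"
    then show "finite (verts G) \<and> card (verts G) < k"
      using rooted_iso_card small_graphsD by (metis fst_conv)
  next
    assume "finite (verts G) \<and> card (verts G) < k"
    then show "\<exists>H\<in>small_graphs k. (G, v) \<simeq>\<^sub>\<star> H"
      using graph_ball_small_iff[OF G(1,3), of k] graph_ball_connected[OF G]
        component_connected_graph[OF G(2,3)] by auto
  qed
  finally show ?thesis .
qed

lemma sum_iso_weight_ball_event: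
  assumes c: "c \<in> Gstar"
  shows "(\<Sum>H\<in>small_graphs k. iso_weight k H * indicator (ball_event k H) c) =
    (indicator (small_event k) c :: real)"
proof -
  obtain G v where G: "(G, v) \<in> c" "v \<in> verts G"
    "\<And>S. S \<in> c \<longleftrightarrow> S \<in> rooted_graphs \<and> (G, v) \<simeq>\<^sub>\<star> S"
    using Gstar_elem[OF c] by metis
  have "(\<Sum>H\<in>small_graphs k. iso_weight k H * indicator (ball_event k H) c) =
      (\<Sum>H\<in>small_graphs k. iso_weight k H * of_bool ((G, v) \<simeq>\<^sub>\<star> H))"
    using ball_event_small_iff[OF c _ G(1,3)]
    by (intro sum.cong) (auto simp: indicator_def)
  also have "\<dots> = of_bool (\<exists>H\<in>small_graphs k. (G, v) \<simeq>\<^sub>\<star> H)"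
    using G(2) by (intro sum_iso_weight) simp
  also have "\<dots> = indicator (small_event k) c"
    using ball_event_small_iff[OF c _ G(1,3)] by (auto simp: small_event_def indicator_def)
  finally show ?thesis .
qed

lemma small_event_limit:
  "incseq small_event" "(\<Union>k. small_event k) = Gstar - infinite_event"
proof -
  have sub: "small_event k \<subseteq> Gstar" for k
    unfolding small_event_def ball_event_def by auto
  show "incseq small_event"
  proof (intro monoI subsetI)
    fix k l :: nat and c assume "k \<le> l" "c \<in> small_event k"
    then have c: "c \<in> Gstar" using sub by auto
    obtain G v where "(G, v) \<in> c" "\<And>S. S \<in> c \<longleftrightarrow> S \<in> rooted_graphs \<and> (G, v) \<simeq>\<^sub>\<star> S"
      using Gstar_elem[OF c] by metis
    then show "c \<in> small_event l"
      using \<open>k \<le> l\<close> \<open>c \<in> small_event k\<close> small_event_iff[OF c] by (meson less_le_trans)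
  qed
  have "c \<in> (\<Union>k. small_event k) \<longleftrightarrow> c \<notin> infinite_event" if c: "c \<in> Gstar" for c
  proof -
    obtain G v where G: "(G, v) \<in> c" "connected_graph G" "v \<in> verts G"
      and iff: "\<And>S. S \<in> c \<longleftrightarrow> S \<in> rooted_graphs \<and> (G, v) \<simeq>\<^sub>\<star> S"
      using Gstar_elem[OF c] by metis
    have "finite (component G' v') \<longleftrightarrow> finite (verts G)" if "(G', v') \<in> c" for G' v'
    proof -
      have "(G', v') \<in> rooted_graphs" using that iff by blast
      then have "component G' v' = verts G'"
        by (simp add: rooted_graphs_def component_connected_graph)
      moreover have "(G, v) \<simeq>\<^sub>\<star> (G', v')" using that iff by blast
      ultimately show ?thesis using rooted_iso_card(1) by fastforce
    qed
    then have "c \<in> infinite_event \<longleftrightarrow> infinite (verts G)"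
      unfolding infinite_event_def using G(1) c by auto
    moreover have "c \<in> (\<Union>k. small_event k) \<longleftrightarrow> finite (verts G)"
      using small_event_iff[OF c G(1) iff] by auto
    ultimately show ?thesis by simp
  qed
  then show "(\<Union>k. small_event k) = Gstar - infinite_event" using sub by blast
qed

lemma space_Gstar_measure:
  assumes "sets \<mu> = sets Gstar_measurable_space"
  shows "space \<mu> = Gstar"
    and "H \<in> rooted_graphs \<Longrightarrow> ball_event r H \<in> sets \<mu>"
    and "small_event k \<in> sets \<mu>"
proof -
  have sub: "{ball_event r H | r H. H \<in> rooted_graphs} \<subseteq> Pow Gstar"
    unfolding ball_event_def by auto
  have "space Gstar_measurable_space = Gstar"
    unfolding Gstar_measurable_space_def using sub by (rule space_measure_of)
  then show "space \<mu> = Gstar" using sets_eq_imp_space_eq[OF assms] by simp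
  have sigma: "sets \<mu> = sigma_sets Gstar {ball_event r H | r H. H \<in> rooted_graphs}"
    using assms sets_measure_of[OF sub] unfolding Gstar_measurable_space_def by simp
  show be: "ball_event r H \<in> sets \<mu>" if "H \<in> rooted_graphs" for r H
    unfolding sigma by (rule sigma_sets.Basic) (use that in blast)
  show "small_event k \<in> sets \<mu>"
    unfolding small_event_def
  proof (rule sets.finite_UN[OF finite_small_graphs])
    fix H assume "H \<in> small_graphs k"
    then have "H \<in> rooted_graphs" by (rule small_graphsD(1))
    then show "ball_event k H \<in> sets \<mu>" by (rule be)
  qed
qed

lemma measure_small_event:
  assumes "prob_space \<mu>" and sets: "sets \<mu> = sets Gstar_measurable_space"
  shows "(\<Sum>H\<in>small_graphs k. iso_weight k H * measure \<mu> (ball_event k H)) =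
    measure \<mu> (small_event k)"
proof -
  interpret prob_space \<mu> by fact
  note sp = space_Gstar_measure[OF sets]
  have "measure \<mu> (small_event k) = (\<integral>c. indicator (small_event k) c \<partial>\<mu>)"
    using sp(3) by simp
  also have "\<dots> = (\<integral>c. (\<Sum>H\<in>small_graphs k. iso_weight k H * indicator (ball_event k H) c) \<partial>\<mu>)"
    using sp(1) by (intro Bochner_Integration.integral_cong refl)
      (simp add: sum_iso_weight_ball_event)
  also have "\<dots> = (\<Sum>H\<in>small_graphs k. \<integral>c. iso_weight k H * indicator (ball_event k H) c \<partial>\<mu>)"
    using sp(2)[OF small_graphsD(1)]
    by (intro Bochner_Integration.integral_sum integrable_mult_right integrable_real_indicator)
      (auto simp: emeasure_eq_measure)
  also have "\<dots> = (\<Sum>H\<in>small_graphs k. iso_weight k H * measure \<mu> (ball_event k H))"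
    using sp(2)[OF small_graphsD(1)] by simp
  finally show ?thesis by simp
qed

lemma measure_small_event_limit:
  assumes "prob_space \<mu>" and sets: "sets \<mu> = sets Gstar_measurable_space"
  shows "(\<lambda>k. measure \<mu> (small_event k)) \<longlonglongrightarrow> 1 - measure \<mu> infinite_event"
proof -
  interpret prob_space \<mu> by fact
  note sp = space_Gstar_measure[OF sets]
  have U: "(\<Union>k. small_event k) \<in> sets \<mu>" using sp(3) by auto
  have "infinite_event \<subseteq> Gstar" by (auto simp: infinite_event_def)
  then have "infinite_event = space \<mu> - (\<Union>k. small_event k)"
    using small_event_limit(2) sp(1) by auto
  then have "measure \<mu> infinite_event = 1 - measure \<mu> (\<Union>k. small_event k)"
    using prob_compl[OF U] by simp
  moreover have "(\<lambda>k. measure \<mu> (small_event k)) \<longlonglongrightarrow> measure \<mu> (\<Union>k. small_event k)"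
    using finite_Lim_measure_incseq[of small_event] small_event_limit(1) sp(3) by (simp add: image_subset_iff)
  ultimately show ?thesis by simp
qed

section \<open>Passing to expectations\<close>

text \<open>Bounded convergence, by splitting the integral at \<open>\<bar>X n - c\<bar> = \<epsilon> / 2\<close>. The spaces vary
  with \<open>n\<close>, so the usual dominated convergence theorem does not apply.\<close>

lemma conv_in_prob_L1:
  assumes prob: "\<And>n. n \<ge> 1 \<Longrightarrow> prob_space (P n)"
    and meas: "\<And>n. n \<ge> 1 \<Longrightarrow> X n \<in> borel_measurable (P n)"
    and bound: "\<And>n \<omega>. n \<ge> 1 \<Longrightarrow> \<omega> \<in> space (P n) \<Longrightarrow> X n \<omega> \<in> {0..1}" and c: "c \<in> {0..1}"
    and conv: "conv_in_prob P X c"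
  shows "(\<lambda>n. \<integral>\<omega>. \<bar>X n \<omega> - c\<bar> \<partial>(P n)) \<longlonglongrightarrow> 0"
proof (rule tendstoI)
  fix \<epsilon> :: real assume "\<epsilon> > 0"
  then have half: "\<epsilon> / 2 > 0" by simp
  let ?A = "\<lambda>n. {\<omega> \<in> space (P n). \<bar>X n \<omega> - c\<bar> > \<epsilon> / 2}"
  have "(\<lambda>n. measure (P n) (?A n)) \<longlonglongrightarrow> 0"
    using conv[unfolded conv_in_prob_def, rule_format, OF half] .
  then have "\<forall>\<^sub>F n in sequentially. measure (P n) (?A n) < \<epsilon> / 2"
    using half by (rule order_tendstoD(2))
  then show "\<forall>\<^sub>F n in sequentially. dist (\<integral>\<omega>. \<bar>X n \<omega> - c\<bar> \<partial>(P n)) 0 < \<epsilon>"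
    using eventually_ge_at_top[of 1]
  proof eventually_elim
    case (elim n)
    interpret prob_space "P n" using prob elim by simp
    have [measurable]: "X n \<in> borel_measurable (P n)" using meas elim by simp
    have le1: "\<bar>X n \<omega> - c\<bar> \<le> 1" if "\<omega> \<in> space (P n)" for \<omega>
      using bound[OF elim(2) that] c by auto
    have [measurable]: "?A n \<in> events" by measurable
    have "(\<integral>\<omega>. \<bar>X n \<omega> - c\<bar> \<partial>(P n)) \<le> (\<integral>\<omega>. \<epsilon> / 2 + indicator (?A n) \<omega> \<partial>(P n))"
    proof (rule integral_mono)
      show "integrable (P n) (\<lambda>\<omega>. \<bar>X n \<omega> - c\<bar>)"
        by (rule integrable_const_bound[where B = 1]) (use le1 in auto)
      show "integrable (P n) (\<lambda>\<omega>. \<epsilon> / 2 + indicator (?A n) \<omega>)"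
        by (intro Bochner_Integration.integrable_add integrable_const integrable_real_indicator)
          (auto simp: emeasure_eq_measure)
      show "\<bar>X n \<omega> - c\<bar> \<le> \<epsilon> / 2 + indicator (?A n) \<omega>" if "\<omega> \<in> space (P n)" for \<omega>
        using le1[OF that] half that by (auto simp: indicator_def)
    qed
    also have "\<dots> = \<epsilon> / 2 + measure (P n) (?A n)"
      by (subst Bochner_Integration.integral_add)
        (auto simp: prob_space emeasure_eq_measure)
    finally have "(\<integral>\<omega>. \<bar>X n \<omega> - c\<bar> \<partial>(P n)) < \<epsilon>" using elim(1) by linarith
    moreover have "0 \<le> (\<integral>\<omega>. \<bar>X n \<omega> - c\<bar> \<partial>(P n))"
      by (intro Bochner_Integration.integral_nonneg abs_ge_zero)
    ultimately show ?case unfolding dist_real_def by linarith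
  qed
qed

text \<open>With \<open>\<zeta>\<^sub>k = 1 - measure \<mu> (small_event k)\<close>, the triangle inequality bounds \<open>\<bar>Z/n - M/n\<bar>\<close> by
  \<open>\<bar>Z/n - \<zeta>\<^sub>k\<bar> + \<bar>\<zeta>\<^sub>k - \<zeta>\<bar> + \<bar>\<zeta> - M/n\<bar>\<close>. The first and last terms vanish in expectation as
  \<open>n\<close> grows; the middle one does not depend on \<open>n\<close>.\<close>

lemma limsup_disconnected_pairs_le:
  fixes P :: "nat \<Rightarrow> 'w measure"
    and G :: "nat \<Rightarrow> 'w \<Rightarrow> 'v graph"
  assumes rg: "\<And>n. n \<ge> 1 \<Longrightarrow> is_random_graph (P n) (G n) n"
    and mu: "prob_space \<mu>" "sets \<mu> = sets Gstar_measurable_space"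
    and loc: "conv_locally_in_prob P G \<mu>"
    and \<zeta>: "\<zeta> \<in> {0..1}"
    and max: "conv_in_prob P (\<lambda>n \<omega>. real (max_component_size (G n \<omega>)) / real n) \<zeta>"
  shows "limsup (\<lambda>n. ereal ((1 / (real n)\<^sup>2) *
      (\<integral>\<omega>. real (card (large_disconnected_pairs k (G n \<omega>))) \<partial>(P n)))) \<le>
    ereal (2 * \<bar>1 - measure \<mu> (small_event k) - \<zeta>\<bar>)"
proof -
  interpret mu: prob_space \<mu> by fact
  define B where "B = (\<lambda>n \<omega>. real (max_component_size (G n \<omega>)) / real n)"
  define F where "F = (\<lambda>H n \<omega>. ball_frequency k H (G n \<omega>))"
  define p where "p = (\<lambda>H. measure \<mu> (ball_event k H))"
  define \<delta> where "\<delta> = \<bar>1 - measure \<mu> (small_event k) - \<zeta>\<bar>"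
  define D where "D = (\<lambda>n \<omega>. real (card (large_disconnected_pairs k (G n \<omega>))))"
  have prob: "prob_space (P n)" if "n \<ge> 1" for n using rg[OF that] by (simp add: is_random_graph_def)
  have graph: "locally_finite_graph (G n \<omega>)" "finite (verts (G n \<omega>))" "card (verts (G n \<omega>)) = n"
      "verts (G n \<omega>) \<noteq> {}"
    if "n \<ge> 1" "\<omega> \<in> space (P n)" for n \<omega> using rg[OF that(1)] that by (auto simp: is_random_graph_def)
  have meas: "(\<lambda>\<omega>. f (G n \<omega>)) \<in> borel_measurable (P n)" if "n \<ge> 1" for n and f :: "'v graph \<Rightarrow> real"
  proof -
    have "G n \<in> P n \<rightarrow>\<^sub>M count_space UNIV" using rg[OF that] by (simp add: is_random_graph_def)
    then show ?thesis by (rule measurable_compose) simp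
  qed
  have Bm: "B n \<in> borel_measurable (P n)" if "n \<ge> 1" for n
    using meas[OF that, of "\<lambda>g. real (max_component_size g) / real n"] unfolding B_def .
  have Fm: "F H n \<in> borel_measurable (P n)" if "n \<ge> 1" for n H
    using meas[OF that, of "ball_frequency k H"] unfolding F_def .
  have B1: "B n \<omega> \<in> {0..1}" if "n \<ge> 1" "\<omega> \<in> space (P n)" for n \<omega>
    using card_large_disconnected_pairs_le(2)[of "G n \<omega>"] graph[OF that] that(1)
    by (simp add: B_def)
  have F1: "F H n \<omega> \<in> {0..1}" if "n \<ge> 1" "\<omega> \<in> space (P n)" for n \<omega> H
  proof -
    have "(\<Sum>v\<in>verts (G n \<omega>). of_bool (graph_ball k (G n \<omega>) v \<simeq>\<^sub>\<star> H)) \<le>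
        (\<Sum>v\<in>verts (G n \<omega>). 1 :: real)"
      by (intro sum_mono) simp
    then show ?thesis
      using graph[OF that] that(1) by (simp add: F_def ball_frequency_def sum_nonneg)
  qed
  have BL: "(\<lambda>n. \<integral>\<omega>. \<bar>B n \<omega> - \<zeta>\<bar> \<partial>(P n)) \<longlonglongrightarrow> 0"
    using max by (intro conv_in_prob_L1 prob Bm B1 \<zeta>) (simp_all add: B_def)
  have FL: "(\<lambda>n. \<integral>\<omega>. \<bar>F H n \<omega> - p H\<bar> \<partial>(P n)) \<longlonglongrightarrow> 0" if "H \<in> small_graphs k" for H
    using loc small_graphsD(1)[OF that] unfolding conv_locally_in_prob_def
    by (intro conv_in_prob_L1 prob Fm F1) (simp_all add: F_def p_def)
  define U where "U = (\<lambda>n. 2 * (\<Sum>H\<in>small_graphs k. iso_weight k H * (\<integral>\<omega>. \<bar>F H n \<omega> - p H\<bar> \<partial>(P n)))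
      + 2 * \<delta> + 2 * (\<integral>\<omega>. \<bar>B n \<omega> - \<zeta>\<bar> \<partial>(P n)))"
  have "U \<longlonglongrightarrow> 2 * (\<Sum>H\<in>small_graphs k. iso_weight k H * 0) + 2 * \<delta> + 2 * 0"
    unfolding U_def by (intro tendsto_intros BL FL)
  then have U: "U \<longlonglongrightarrow> 2 * \<delta>" by simp
  have pointwise: "(1 / (real n)\<^sup>2) * D n \<omega> \<le>
      2 * (\<Sum>H\<in>small_graphs k. iso_weight k H * \<bar>F H n \<omega> - p H\<bar>) + 2 * \<delta> + 2 * \<bar>B n \<omega> - \<zeta>\<bar>"
    if n: "n \<ge> 1" and \<omega>: "\<omega> \<in> space (P n)" for n \<omega>
  proof -
    note g = graph[OF n \<omega>]
    have tri: "\<bar>a - b\<bar> \<le> \<bar>a - c\<bar> + \<bar>c - d\<bar> + \<bar>b - d\<bar>" for a b c d :: real by linarith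
    define z where "z = real (card (large_component_verts k (G n \<omega>))) / real n"
    have z: "z = 1 - (\<Sum>H\<in>small_graphs k. iso_weight k H * F H n \<omega>)"
      using large_component_frequency[OF g(1,2,4), of k] g(3) by (simp add: z_def F_def)
    have "(1 / (real n)\<^sup>2) * D n \<omega> \<le> (1 / (real n)\<^sup>2) * (2 * real n *
        \<bar>real (card (large_component_verts k (G n \<omega>))) - real (max_component_size (G n \<omega>))\<bar>)"
      using card_large_disconnected_pairs_le(1)[OF g(2,4), of k] g(3) unfolding D_def
      by (intro mult_left_mono) auto
    also have "\<dots> = 2 * \<bar>(real (card (large_component_verts k (G n \<omega>))) - real (max_component_size (G n \<omega>))) / real n\<bar>"
      using n by (simp add: power2_eq_square abs_divide)
    also have "\<dots> = 2 * \<bar>z - B n \<omega>\<bar>" by (simp add: z_def B_def diff_divide_distrib)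
    also have "\<dots> \<le> 2 * (\<bar>z - (1 - measure \<mu> (small_event k))\<bar> + \<delta> + \<bar>B n \<omega> - \<zeta>\<bar>)"
      unfolding \<delta>_def by (intro mult_left_mono tri) simp
    also have "\<bar>z - (1 - measure \<mu> (small_event k))\<bar> =
        \<bar>\<Sum>H\<in>small_graphs k. iso_weight k H * (F H n \<omega> - p H)\<bar>"
      unfolding z measure_small_event[OF mu, symmetric] p_def
      by (simp add: right_diff_distrib sum_subtractf abs_minus_commute)
    also have "\<dots> \<le> (\<Sum>H\<in>small_graphs k. iso_weight k H * \<bar>F H n \<omega> - p H\<bar>)"
      by (rule order_trans[OF sum_abs]) (simp add: abs_mult iso_weight_nonneg)
    finally show ?thesis by simp
  qed
  have DU: "(1 / (real n)\<^sup>2) * (\<integral>\<omega>. D n \<omega> \<partial>(P n)) \<le> U n" if n: "n \<ge> 1" for n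
  proof -
    interpret prob_space "P n" using prob[OF n] .
    have [measurable]: "B n \<in> borel_measurable (P n)" "F H n \<in> borel_measurable (P n)" for H
      using Bm Fm n by auto
    have Bi: "integrable (P n) (\<lambda>\<omega>. \<bar>B n \<omega> - \<zeta>\<bar>)"
    proof (rule integrable_const_bound[where B = 1])
      have "norm \<bar>B n \<omega> - \<zeta>\<bar> \<le> 1" if "\<omega> \<in> space (P n)" for \<omega>
        using B1[OF n that] \<zeta> by auto
      then show "AE \<omega> in P n. norm \<bar>B n \<omega> - \<zeta>\<bar> \<le> 1" by auto
    qed simp
    have Fi: "integrable (P n) (\<lambda>\<omega>. \<bar>F H n \<omega> - p H\<bar>)" for H
    proof (rule integrable_const_bound[where B = 1])
      have "p H \<in> {0..1}" by (simp add: p_def)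
      then have "norm \<bar>F H n \<omega> - p H\<bar> \<le> 1" if "\<omega> \<in> space (P n)" for \<omega>
        using F1[OF n that, of H] by auto
      then show "AE \<omega> in P n. norm \<bar>F H n \<omega> - p H\<bar> \<le> 1" by auto
    qed simp
    have "(1 / (real n)\<^sup>2) * (\<integral>\<omega>. D n \<omega> \<partial>(P n)) = (\<integral>\<omega>. (1 / (real n)\<^sup>2) * D n \<omega> \<partial>(P n))"
      by simp
    also have "\<dots> \<le> (\<integral>\<omega>. 2 * (\<Sum>H\<in>small_graphs k. iso_weight k H * \<bar>F H n \<omega> - p H\<bar>)
        + 2 * \<delta> + 2 * \<bar>B n \<omega> - \<zeta>\<bar> \<partial>(P n))"
    proof (rule integral_mono')
      show "integrable (P n) (\<lambda>\<omega>. 2 * (\<Sum>H\<in>small_graphs k. iso_weight k H * \<bar>F H n \<omega> - p H\<bar>)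
          + 2 * \<delta> + 2 * \<bar>B n \<omega> - \<zeta>\<bar>)"
        using Bi Fi by auto
      show "0 \<le> 2 * (\<Sum>H\<in>small_graphs k. iso_weight k H * \<bar>F H n \<omega> - p H\<bar>)
          + 2 * \<delta> + 2 * \<bar>B n \<omega> - \<zeta>\<bar>" for \<omega>
        by (intro add_nonneg_nonneg mult_nonneg_nonneg sum_nonneg)
          (simp_all add: iso_weight_nonneg \<delta>_def)
    qed (rule pointwise[OF n])
    also have "\<dots> = U n"
      using Bi Fi by (simp add: U_def prob_space)
    finally show ?thesis .
  qed
  have "limsup (\<lambda>n. ereal ((1 / (real n)\<^sup>2) * (\<integral>\<omega>. D n \<omega> \<partial>(P n)))) \<le> limsup (\<lambda>n. ereal (U n))"
  proof (rule Limsup_mono)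
    show "\<forall>\<^sub>F n in sequentially. ereal ((1 / (real n)\<^sup>2) * (\<integral>\<omega>. D n \<omega> \<partial>(P n))) \<le> ereal (U n)"
      using eventually_ge_at_top[of 1] by eventually_elim (use DU in \<open>simp only: ereal_less_eq\<close>)
  qed
  also have "\<dots> = ereal (2 * \<delta>)"
    using U by (intro lim_imp_Limsup) auto
  finally show ?thesis unfolding D_def \<delta>_def .
qed

theorem mainTheorem3:
  fixes P :: "nat \<Rightarrow> 'w measure"
    and G :: "nat \<Rightarrow> 'w \<Rightarrow> 'v graph"
    and \<mu> :: "nat rooted_graph set measure"
    and \<zeta> :: real
  assumes "\<And>n. n \<ge> 1 \<Longrightarrow> is_random_graph (P n) (G n) n"
    and "prob_space \<mu>"
    and "sets \<mu> = sets Gstar_measurable_space"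
    and "conv_locally_in_prob P G \<mu>"
    and "\<zeta> = measure \<mu> infinite_event"
    and "conv_in_prob P (\<lambda>n \<omega>. real (max_component_size (G n \<omega>)) / real n) \<zeta>"
  shows "(\<lambda>k. limsup (\<lambda>n. ereal ((1 / (real n)\<^sup>2) *
           (\<integral>\<omega>. real (card (large_disconnected_pairs k (G n \<omega>))) \<partial>(P n))))) \<longlonglongrightarrow> 0"
proof (rule tendsto_sandwich[OF _ _ tendsto_const])
  interpret mu: prob_space \<mu> by fact
  let ?L = "\<lambda>k n. ereal ((1 / (real n)\<^sup>2) *
           (\<integral>\<omega>. real (card (large_disconnected_pairs k (G n \<omega>))) \<partial>(P n)))"
  let ?u = "\<lambda>k. 2 * \<bar>1 - measure \<mu> (small_event k) - \<zeta>\<bar>"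
  have "0 \<le> limsup (?L k)" for k
  proof (rule le_Limsup)
    show "\<forall>\<^sub>F n in sequentially. 0 \<le> ?L k n"
      by (intro always_eventually allI) (simp add: Bochner_Integration.integral_nonneg)
  qed simp
  then show "\<forall>\<^sub>F k in sequentially. 0 \<le> limsup (?L k)" by simp
  have "limsup (?L k) \<le> ereal (?u k)" for k
    using assms by (intro limsup_disconnected_pairs_le) auto
  then show "\<forall>\<^sub>F k in sequentially. limsup (?L k) \<le> ereal (?u k)" by simp
  have "(\<lambda>k. measure \<mu> (small_event k)) \<longlonglongrightarrow> 1 - \<zeta>"
    using measure_small_event_limit[OF assms(2,3)] assms(5) by simp
  then have "?u \<longlonglongrightarrow> 2 * \<bar>1 - (1 - \<zeta>) - \<zeta>\<bar>"
    by (intro tendsto_mult tendsto_rabs tendsto_diff tendsto_const)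
  then have "?u \<longlonglongrightarrow> 0" by simp
  then show "(\<lambda>k. ereal (?u k)) \<longlonglongrightarrow> 0"
    unfolding zero_ereal_def by (rule tendsto_ereal)
qed

end
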